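(* Let $k\ge2$ be an integer, $t>0$, and $1<\alpha<\alpha_k$, where $$\alpha_k:=\frac{k-1+\sqrt{(k-1)^2+8}}{2}.$$ Let $\mathcal{P}=\{P_1,\ldots,P_k\}\subseteq\operatorname{Int}(\mathbb{Z})$ with $P_1,\ldots,P_k$ pairwise distinct, and put $$A_{t,\alpha,\mathcal{P}}:=\mathbb{N}\cap\{\lfloor t\alpha^n\rfloor+P(n):n\in\mathbb{N},\ P\in\mathcal{P}\}$$ and $$d_{\mathcal{P}}:=\gcd\left(\{P_i(n)-P_j(n):n\in\mathbb{Z},\ 1\le i<j\le k\}\right).$$ Then the following are equivalent: (1) $A_{t,\alpha,\mathcal{P}}$ is strongly complete; (2) $\sum_{a\in A_{t,\alpha,\mathcal{P}}}\|a\theta\|=\infty$ for all $\theta\in\mathbb{T}\setminus\{0\}$; (3) for every prime $p\mid d_{\mathcal{P}}$, $p\nmid\lfloor t\alpha^n\rfloor+P_1(n)$ for infinitely many $n\in\mathbb{N}$. In particular, $A_{t,\alpha,\mathcal{P}}$ is strongly complete if $d_{\mathcal{P}}=1$.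
   Context: $\mathbb{N}=\{1,2,3,\ldots\}$ and $\mathbb{T}=\mathbb{R}/\mathbb{Z}$. $\|x\|$ denotes the distance from $x$ to the nearest integer. $\operatorname{Int}(\mathbb{Z})$ is the set of integer-valued polynomials, i.e. polynomials $P$ with rational coefficients such that $P(n)\in\mathbb{Z}$ for all $n\in\mathbb{Z}$. For $S\subseteq\mathbb{Z}$ containing a nonzero element, $\gcd(S)$ is the largest $d\in\mathbb{N}$ dividing every element of $S$. A set $A\subseteq\mathbb{N}$ is complete if every sufficiently large positive integer is a sum of distinct elements of $A$, and strongly complete if $A\setminus B$ is complete for every finite subset $B\subseteq A$. *)

theory Defs
  imports "HOL-Analysis.Analysis" "HOL-Computational_Algebra.Computational_Algebra"
begin

definition complete_set :: "nat set \<Rightarrow> bool" where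
  "complete_set A \<longleftrightarrow>
     (\<exists>N. \<forall>n\<ge>N. \<exists>F. finite F \<and> F \<subseteq> A \<and> n = \<Sum>F)"

definition strongly_complete :: "nat set \<Rightarrow> bool" where
  "strongly_complete A \<longleftrightarrow>
     (\<forall>B. B \<subseteq> A \<longrightarrow> finite B \<longrightarrow> complete_set (A - B))"

definition dist_nearest_int :: "real \<Rightarrow> real" where
  "dist_nearest_int x = \<bar>x - of_int (round x)\<bar>"

text \<open>The value depends only on the class of \<open>x\<close> in \<open>\<real>/\<int>\<close>, so for natural \<open>a\<close> the value at
  \<open>a * \<theta>\<close> depends only on the class of \<open>\<theta>\<close>.\<close>

lemma dist_nearest_int_add_of_int: "dist_nearest_int (x + of_int m) = dist_nearest_int x"
proof -
  have "round (x + of_int m) = round x + m"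
    unfolding round_def by linarith
  then show ?thesis
    by (simp add: dist_nearest_int_def)
qed

definition int_valued_polys :: "rat poly set" where
  "int_valued_polys = {P. \<forall>n::int. poly P (of_int n) \<in> \<int>}"

text \<open>For \<open>P \<in> int_valued_polys\<close> the floor is exact; it only converts \<open>P(n)\<close> from \<open>rat\<close> to \<open>int\<close>.\<close>

definition int_poly_val :: "rat poly \<Rightarrow> int \<Rightarrow> int" where
  "int_poly_val P n = \<lfloor>poly P (of_int n)\<rfloor>"

lemma of_int_int_poly_val:
  "P \<in> int_valued_polys \<Longrightarrow> of_int (int_poly_val P n) = poly P (of_int n)"
  by (simp add: int_valued_polys_def int_poly_val_def)

definition alpha_bound :: "nat \<Rightarrow> real" where
  "alpha_bound k = (real k - 1 + sqrt ((real k - 1)\<^sup>2 + 8)) / 2"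

definition seq_term :: "real \<Rightarrow> real \<Rightarrow> rat poly \<Rightarrow> nat \<Rightarrow> int" where
  "seq_term t \<alpha> P n = \<lfloor>t * \<alpha> ^ n\<rfloor> + int_poly_val P (int n)"

definition seq_set :: "real \<Rightarrow> real \<Rightarrow> rat poly set \<Rightarrow> nat set" where
  "seq_set t \<alpha> \<P> = {a. 1 \<le> a \<and> (\<exists>n\<ge>1. \<exists>P\<in>\<P>. int a = seq_term t \<alpha> P n)}"

definition diff_gcd :: "nat \<Rightarrow> (nat \<Rightarrow> rat poly) \<Rightarrow> int" where
  "diff_gcd k P =
     Gcd {int_poly_val (P i) n - int_poly_val (P j) n | n i j. 1 \<le> i \<and> i < j \<and> j \<le> k}"

end

theory Submission
  imports Defs "HOL-Number_Theory.Cong" "HOL-Real_Asymp.Real_Asymp"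
begin

text \<open>Write \<open>A\<close> for the set in the theorem and \<open>a\<^sub>i(n) = \<lfloor>t\<alpha>\<^sup>n\<rfloor> + P\<^sub>i(n)\<close>; call \<open>a\<^sub>1(n), \<dots>, a\<^sub>k(n)\<close> the level \<open>n\<close>.
The proof goes round the cycle (1), (2), (3).

If \<open>A\<close> is strongly complete but \<open>\<Sum>\<parallel>a\<theta>\<parallel>\<close> converges, then after deleting finitely many elements every
sum of distinct elements has \<open>\<parallel>\<cdot> \<theta>\<parallel> < \<parallel>\<theta>\<parallel>/2\<close>; two consecutive integers \<open>N, N + 1\<close> of that form give
\<open>\<parallel>\<theta>\<parallel> < \<parallel>\<theta>\<parallel>\<close> (\<open>strongly_complete_imp_divergent\<close>).  If (3) fails at \<open>p\<close>, then all but finitely many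
elements of \<open>A\<close> are multiples of \<open>p\<close>, because all \<open>a\<^sub>i(n)\<close> with the same \<open>n\<close> agree modulo \<open>p\<close>; so
\<open>\<theta> = 1/p\<close> violates (2) (\<open>divergent_imp_infinite_nondivisible\<close>).

The substance is that (3) implies (1).  Condition (3) says exactly that no prime divides all but
finitely many elements of \<open>A\<close>: a prime not dividing the gcd of the differences fails to divide some
\<open>P\<^sub>i(m) - P\<^sub>j(m)\<close>, hence fails to do so for infinitely many arguments by periodicity.  Finite deletions
do not matter, so it is enough to show completeness (\<open>complete_if_exponential_levels\<close>).  Fix a large
spacing \<open>g\<close>.  At the levels divisible by \<open>g\<close> the two elements \<open>a\<^sub>1(n), a\<^sub>2(n)\<close> are put aside, and
the remaining elements are used to extend intervals.

\<^item> Out of the elements put aside one makes exchanges.  Iterated differences of the nonzero polynomial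
  \<open>P\<^sub>1 - P\<^sub>2\<close> with steps that are multiples of \<open>g\<close> end in a nonzero constant \<open>\<plusminus>c\<close>; taking
  \<open>a\<^sub>1(n)\<close> or \<open>a\<^sub>2(n)\<close> according to the signs gives two sets \<open>X, Y\<close> with \<open>\<Sum>X = \<Sum>Y + c\<close>, as far out
  as desired.  Disjoint exchanges produce arbitrarily long progressions of difference \<open>c\<close>
  (\<open>constant_signed_sum\<close>, \<open>exchange_blocks\<close>, \<open>exchanges_give_progression\<close>).
\<^item> The condition on primes yields a finite \<open>F \<subseteq> A\<close> whose subset sums meet every class modulo \<open>c\<close>
  (\<open>subset_sums_cover_residues\<close>).  Together with the progressions this makes intervals of subset sums
  as long as desired (\<open>exchanges_give_interval\<close>).
\<^item> An interval of length \<open>C\<close> extends level by level to a half-line if each element of level \<open>n\<close> is at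
  most \<open>C\<close> plus the sum of all remaining elements of earlier levels (\<open>subset_sums_fill_levels\<close>).  The
  worst case is that level \<open>n - 1\<close> is the only recent one with two elements missing, and then the
  leading terms require \<open>1 < k/(\<alpha> - 1) - 2/\<alpha>\<close>, that is \<open>\<alpha>\<^sup>2 < (k - 1)\<alpha> + 2\<close>, that is \<open>\<alpha> < \<alpha>\<^sub>k\<close>.  The
  strict inequality leaves room for the polynomials, the rounding and a finite spacing \<open>g\<close>
  (\<open>growth_constants\<close>, \<open>sum_depleted_levels_ge\<close>).

The length \<open>C\<close> depends on where the levels start, hence on \<open>F\<close> and \<open>c\<close>, but not on how many exchanges
are used; this is what makes the choices consistent.\<close>

section \<open>Subset sums and intervals\<close>

definition subset_sums :: "nat set \<Rightarrow> nat set" where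
  "subset_sums Z = {\<Sum>F | F. finite F \<and> F \<subseteq> Z}"

lemma subset_sumsI: "finite F \<Longrightarrow> F \<subseteq> Z \<Longrightarrow> \<Sum>F \<in> subset_sums Z"
  by (auto simp: subset_sums_def)

lemma subset_sums_mono: "Y \<subseteq> Z \<Longrightarrow> subset_sums Y \<subseteq> subset_sums Z"
  by (fastforce simp: subset_sums_def)

lemma subset_sums_add:
  assumes "x \<in> subset_sums Y" "y \<in> subset_sums Z" "Y \<inter> Z = {}"
  shows "x + y \<in> subset_sums (Y \<union> Z)"
proof -
  obtain F G where F: "finite F" "F \<subseteq> Y" "x = \<Sum>F" and G: "finite G" "G \<subseteq> Z" "y = \<Sum>G"
    using assms(1,2) by (auto simp: subset_sums_def)
  have "F \<inter> G = {}" using F G assms(3) by blast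
  then have "x + y = \<Sum>(F \<union> G)"
    using F G by (simp add: sum.union_disjoint)
  then show ?thesis using F G subset_sumsI[of "F \<union> G" "Y \<union> Z"] by auto
qed

lemma complete_set_iff_subset_sums: "complete_set A \<longleftrightarrow> (\<exists>N. {N..} \<subseteq> subset_sums A)"
  by (simp add: complete_set_def subset_sums_def subset_iff conj_commute conj_left_commute)

text \<open>Adding one element \<open>f\<close> joins an interval to its translate by \<open>f\<close>, and there is no gap between them as
long as \<open>f\<close> does not exceed the length.  The length only grows, so the elements of \<open>F\<close> may be
added in any order.\<close>

lemma subset_sums_interval_extend:
  assumes "finite F" "{x..x + L} \<subseteq> subset_sums Z" "F \<inter> Z = {}" "\<And>f. f \<in> F \<Longrightarrow> f \<le> L"
  shows "{x..x + L + \<Sum>F} \<subseteq> subset_sums (Z \<union> F)"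
  using assms
proof (induction F)
  case empty
  then show ?case by simp
next
  case (insert f F)
  have IH: "{x..x + L + \<Sum>F} \<subseteq> subset_sums (Z \<union> F)" using insert by simp
  have f: "f \<le> L" using insert by simp
  show ?case
  proof
    fix y assume y: "y \<in> {x..x + L + \<Sum>(insert f F)}"
    show "y \<in> subset_sums (Z \<union> insert f F)"
    proof (cases "y \<le> x + L + \<Sum>F")
      case True
      then have "y \<in> subset_sums (Z \<union> F)" using IH y by auto
      then show ?thesis using subset_sums_mono[of "Z \<union> F" "Z \<union> insert f F"] by auto
    next
      case False
      then have "y - f \<in> {x..x + L + \<Sum>F}" using y f insert.hyps by auto
      then have "y - f \<in> subset_sums (Z \<union> F)" using IH by blast
      moreover have "f \<in> subset_sums {f}" using subset_sumsI[of "{f}" "{f}"] by simp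
      ultimately have "y - f + f \<in> subset_sums ((Z \<union> F) \<union> {f})"
        using insert.hyps insert.prems by (intro subset_sums_add) auto
      then show ?thesis using False f by (simp add: Un_commute)
    qed
  qed
qed

text \<open>The bound \<open>h n\<close> stands for the size of level \<open>n\<close>; it is kept apart from the level itself because a level
may be empty (for \<open>k = 2\<close> nothing remains where two elements have been put aside), while the sums of
the levels still have to be seen to be unbounded.\<close>

lemma subset_sums_fill_levels:
  fixes E :: "nat \<Rightarrow> nat set" and h :: "nat \<Rightarrow> nat"
  assumes int: "{x..x + C} \<subseteq> subset_sums Z"
    and fin: "\<And>n. finite (E n)"
    and disjZ: "\<And>n. n \<ge> n0 \<Longrightarrow> E n \<inter> Z = {}"
    and disj: "\<And>m n. n0 \<le> m \<Longrightarrow> m < n \<Longrightarrow> E m \<inter> E n = {}"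
    and le_h: "\<And>n e. n \<ge> n0 \<Longrightarrow> e \<in> E n \<Longrightarrow> e \<le> h n"
    and h_le: "\<And>n. n \<ge> n0 \<Longrightarrow> h n \<le> C + (\<Sum>m=n0..<n. \<Sum>(E m))"
    and unb: "\<And>N. \<exists>n\<ge>n0. N \<le> h n"
  shows "{x..} \<subseteq> subset_sums (Z \<union> (\<Union>n\<in>{n0..}. E n))"
proof -
  have step: "{x..x + C + (\<Sum>m=n0..<n. \<Sum>(E m))} \<subseteq> subset_sums (Z \<union> (\<Union>m\<in>{n0..<n}. E m))"
    if "n \<ge> n0" for n
    using that
  proof (induction n rule: dec_induct)
    case base
    then show ?case using int by simp
  next
    case (step n)
    have D: "E n \<inter> (Z \<union> (\<Union>m\<in>{n0..<n}. E m)) = {}"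
      using disjZ[of n] disj[of _ n] step by fastforce
    have "{x..x + (C + (\<Sum>m=n0..<n. \<Sum>(E m))) + \<Sum>(E n)} \<subseteq> subset_sums ((Z \<union> (\<Union>m\<in>{n0..<n}. E m)) \<union> E n)"
      by (rule subset_sums_interval_extend[OF fin _ D])
         (use step le_h[of n] h_le[of n] in \<open>auto simp: add.assoc intro: order_trans\<close>)
    moreover have "{n0..<Suc n} = insert n {n0..<n}" using step by auto
    ultimately show ?case using step by (simp add: add_ac Un_ac)
  qed
  show ?thesis
  proof
    fix y assume "y \<in> {x..}"
    obtain n where n: "n \<ge> n0" "y \<le> h n" using unb by blast
    then have "y \<in> {x..x + C + (\<Sum>m=n0..<n. \<Sum>(E m))}" using h_le[of n] \<open>y \<in> {x..}\<close> by auto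
    then have "y \<in> subset_sums (Z \<union> (\<Union>m\<in>{n0..<n}. E m))" using step n by blast
    then show "y \<in> subset_sums (Z \<union> (\<Union>n\<in>{n0..}. E n))"
      by (rule subsetD[OF subset_sums_mono, rotated]) auto
  qed
qed

section \<open>Subset sums and residue classes\<close>

text \<open>Choose a finite \<open>F \<subseteq> A\<close> whose subset sums meet as many residue classes as possible.  Adjoining a further
\<open>a \<in> A\<close> gains nothing, so translation by \<open>a\<close> preserves the set of residues met.  The
translations preserving it form a subgroup \<open>m\<int>\<close> with \<open>m\<close> dividing \<open>c\<close>, and a prime dividing \<open>m\<close> would
divide every element of \<open>A\<close> outside \<open>F\<close>.  Hence \<open>m = 1\<close> and every residue is met.\<close>

lemma subset_sums_cover_residues:
  fixes c :: nat
  assumes c: "c > 0" and inf: "\<And>p. prime p \<Longrightarrow> p dvd c \<Longrightarrow> infinite {a \<in> A. \<not> p dvd a}"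
  shows "\<exists>F. finite F \<and> F \<subseteq> A \<and> (\<forall>r::int. \<exists>s\<in>subset_sums F. [int s = r] (mod int c))"
proof -
  \<comment> \<open>\<open>H F\<close> is the union of the classes that are met, \<open>R F\<close> its set of representatives.\<close>
  define H where "H F = {x::int. \<exists>s\<in>subset_sums F. [int s = x] (mod int c)}" for F
  define R where "R F = H F \<inter> {0..<int c}" for F
  have finR: "finite (R F)" and cardR: "card (R F) \<le> c" for F
  proof -
    show "finite (R F)" by (simp add: R_def)
    show "card (R F) \<le> c"
      using card_mono[of "{0..<int c}" "R F"] by (simp add: R_def)
  qed
  have H_mod: "x mod int c \<in> H F \<longleftrightarrow> x \<in> H F" for x F
    unfolding H_def cong_def by simp
  have "\<exists>F. (finite F \<and> F \<subseteq> A) \<and> (\<forall>G. (finite G \<and> G \<subseteq> A) \<longrightarrow> card (R G) \<le> card (R F))"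
    by (rule ex_has_greatest_nat[of _ "{}" _ "Suc c"]) (use cardR in \<open>auto simp: less_Suc_eq_le\<close>)
  then obtain F where F: "finite F" "F \<subseteq> A"
    and max: "\<And>G. finite G \<Longrightarrow> G \<subseteq> A \<Longrightarrow> card (R G) \<le> card (R F)"
    by (elim exE conjE) simp
  define T where "T = {z::int. \<forall>x. x \<in> H F \<longrightarrow> x + z \<in> H F}"
  have AT: "int a \<in> T" if a: "a \<in> A" "a \<notin> F" for a
  proof -
    have sub: "R F \<subseteq> R (insert a F)"
      using subset_sums_mono[of F "insert a F"] unfolding R_def H_def by blast
    have "R F = R (insert a F)"
      by (rule card_subset_eq[OF finR sub])
         (rule antisym[OF card_mono[OF finR sub] max], use a F in auto)
    have "x + int a \<in> H F" if x: "x \<in> H F" for x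
    proof -
      obtain s where s: "s \<in> subset_sums F" "[int s = x] (mod int c)" using x by (auto simp: H_def)
      have "s + a \<in> subset_sums (F \<union> {a})"
        using subset_sums_add[OF s(1), of a "{a}"] subset_sumsI[of "{a}" "{a}"] a by auto
      moreover have "[int (s + a) = x + int a] (mod int c)" using s(2) by (simp add: cong_add_rcancel)
      ultimately have "x + int a \<in> H (insert a F)" unfolding H_def by (intro CollectI bexI[of _ "s + a"]) simp_all
      then have "(x + int a) mod int c \<in> R (insert a F)"
        using c by (simp add: R_def H_mod)
      then have "(x + int a) mod int c \<in> R F"
        using \<open>R F = R (insert a F)\<close> by blast
      then show ?thesis
        by (simp add: R_def H_mod)
    qed
    then show ?thesis by (simp add: T_def)
  qed
  have T_add: "y + z \<in> T" if "y \<in> T" "z \<in> T" for y z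
    using that by (auto simp: T_def add.assoc[symmetric])
  have T_c: "int c * q \<in> T" for q
  proof -
    have "x + int c * q \<in> H F \<longleftrightarrow> x \<in> H F" for x
      using H_mod[of "x + int c * q" F] by (simp add: H_mod)
    then show ?thesis by (simp add: T_def)
  qed
  have T_mult: "int n * z \<in> T" if "z \<in> T" for n z
  proof (induction n)
    case 0
    show ?case using T_c[of 0] by simp
  next
    case (Suc n)
    then show ?case using T_add[OF that Suc] by (simp add: algebra_simps)
  qed
  have T_diff: "z - y * int n \<in> T" if "z \<in> T" "y \<in> T" for y z n
  proof -
    \<comment> \<open>Since \<open>T\<close> contains all multiples of \<open>c\<close>, subtracting \<open>y\<close> amounts to adding \<open>(c - 1) * y\<close>.\<close>
    have "z + (int (n * (c - 1)) * y + int c * (- y * int n)) \<in> T"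
      by (intro T_add T_mult T_c that)
    moreover have "z + (int (n * (c - 1)) * y + int c * (- y * int n)) = z - y * int n"
      using c by (simp add: of_nat_diff algebra_simps)
    ultimately show ?thesis by simp
  qed
  define m where "m = (LEAST m. m > 0 \<and> int m \<in> T)"
  have m: "m > 0" "int m \<in> T"
    using LeastI[of "\<lambda>m. m > 0 \<and> int m \<in> T" c] c T_c[of 1] by (auto simp: m_def)
  have m_dvd: "m dvd n" if "int n \<in> T" for n
  proof (rule ccontr)
    assume "\<not> m dvd n"
    then have "n mod m > 0" by (simp add: dvd_eq_mod_eq_0)
    moreover have "int (n mod m) \<in> T"
      using T_diff[OF that m(2), of "n div m"]
      by (simp add: zmod_int minus_mult_div_eq_mod zdiv_int)
    ultimately have "m \<le> n mod m" unfolding m_def by (intro Least_le) auto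
    then show False using m(1) by (meson mod_less_divisor not_le)
  qed
  have "m = 1"
  proof (rule ccontr)
    assume "m \<noteq> 1"
    then obtain p where p: "prime p" "p dvd m" using prime_factor_nat by blast
    have "p dvd c" using p m_dvd[of c] T_c[of 1] by (auto intro: dvd_trans)
    then have "infinite {a \<in> A. \<not> p dvd a}" using inf p by blast
    moreover have "{a \<in> A. \<not> p dvd a} \<subseteq> F"
      using AT m_dvd p by (auto intro: dvd_trans)
    ultimately show False using F finite_subset by blast
  qed
  then have one: "int n \<in> T" for n using T_mult[OF m(2), of n] by simp
  have "0 \<in> H F" using subset_sumsI[of "{}" F] by (auto simp: H_def intro!: bexI[of _ 0])
  have "\<exists>s\<in>subset_sums F. [int s = r] (mod int c)" for r
  proof -
    have "0 + int (nat (r mod int c)) \<in> H F"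
      using one[of "nat (r mod int c)"] \<open>0 \<in> H F\<close> unfolding T_def by blast
    then have "r \<in> H F" using c by (simp add: H_mod)
    then show ?thesis by (simp add: H_def)
  qed
  then show ?thesis using F by blast
qed

section \<open>Exchanges\<close>

text \<open>From each of \<open>K\<close> disjoint pairs \<open>X, Y\<close> take one side; the number of times \<open>X\<close> is taken determines
the sum.  Disjointness comes for free because the pairs are available arbitrarily far out.\<close>

lemma exchanges_give_progression:
  assumes ex: "\<And>N. \<exists>X Y. finite X \<and> finite Y \<and> X \<subseteq> U \<and> Y \<subseteq> U \<and> (\<forall>u\<in>X \<union> Y. N < u) \<and> \<Sum>X = \<Sum>Y + c"
  shows "\<exists>x Q. finite Q \<and> Q \<subseteq> U \<and> (\<forall>j\<le>K. x + j * c \<in> subset_sums Q)"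
proof (induction K)
  case 0
  show ?case using subset_sumsI[of "{}" "{}"] by (intro exI[of _ 0] exI[of _ "{}"]) auto
next
  case (Suc K)
  then obtain x Q where Q: "finite Q" "Q \<subseteq> U" "\<And>j. j \<le> K \<Longrightarrow> x + j * c \<in> subset_sums Q"
    by blast
  obtain X Y where XY: "finite X" "finite Y" "X \<subseteq> U" "Y \<subseteq> U" "\<forall>u\<in>X \<union> Y. \<Sum>Q < u" "\<Sum>X = \<Sum>Y + c"
    using ex[of "\<Sum>Q"] by (elim exE conjE)
  have "q \<le> \<Sum>Q" if "q \<in> Q" for q
    using member_le_sum[of q Q "\<lambda>x. x"] Q(1) that by simp
  then have disj: "Q \<inter> (X \<union> Y) = {}"
    using XY(5) by (meson disjoint_iff leD)
  have "x + \<Sum>Y + j * c \<in> subset_sums (Q \<union> (X \<union> Y))" if j: "j \<le> Suc K" for j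
  proof (cases "j \<le> K")
    case True
    have "x + j * c + \<Sum>Y \<in> subset_sums (Q \<union> (X \<union> Y))"
      by (rule subset_sums_add[OF Q(3)[OF True] subset_sumsI disj]) (use XY in auto)
    then show ?thesis by (simp add: add_ac)
  next
    case False
    then have "j = Suc K" using j by simp
    have "x + K * c + \<Sum>X \<in> subset_sums (Q \<union> (X \<union> Y))"
      by (rule subset_sums_add[OF Q(3)[OF order_refl] subset_sumsI disj]) (use XY in auto)
    then show ?thesis using XY(6) \<open>j = Suc K\<close> by (simp add: add_ac)
  qed
  then show ?case
    using Q XY by (intro exI[of _ "x + \<Sum>Y"] exI[of _ "Q \<union> (X \<union> Y)"]) auto
qed

text \<open>Correct the residue of a target modulo \<open>c\<close> by a subset sum \<open>s\<close> of \<open>F\<close>, and reach the rest along the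
progression.  As \<open>s \<le> \<Sum>F\<close>, starting \<open>\<Sum>F\<close> above the base of the progression keeps the remainder
nonnegative, and \<open>\<Sum>F + L\<close> steps suffice.\<close>

lemma exchanges_give_interval:
  fixes c :: nat
  assumes c: "c > 0" and F: "finite F" "F \<inter> U = {}"
    and res: "\<And>r::int. \<exists>s\<in>subset_sums F. [int s = r] (mod int c)"
    and ex: "\<And>N. \<exists>X Y. finite X \<and> finite Y \<and> X \<subseteq> U \<and> Y \<subseteq> U \<and> (\<forall>u\<in>X \<union> Y. N < u) \<and> \<Sum>X = \<Sum>Y + c"
  shows "\<exists>x. {x..x + L} \<subseteq> subset_sums (F \<union> U)"
proof -
  have "\<exists>x Q. finite Q \<and> Q \<subseteq> U \<and> (\<forall>j\<le>\<Sum>F + L. x + j * c \<in> subset_sums Q)"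
    by (rule exchanges_give_progression[OF ex])
  then obtain x Q where Q: "Q \<subseteq> U" "\<forall>j\<le>\<Sum>F + L. x + j * c \<in> subset_sums Q"
    by (elim exE conjE)
  have "y \<in> subset_sums (F \<union> U)" if y: "y \<in> {x + \<Sum>F..x + \<Sum>F + L}" for y
  proof -
    obtain s where s: "s \<in> subset_sums F" "[int s = int y - int x] (mod int c)"
      using res by blast
    have "s \<le> \<Sum>F" using s(1) F(1) by (auto simp: subset_sums_def intro: sum_mono2)
    then have sy: "x + s \<le> y" using y by simp
    have "int c dvd int (y - x - s)"
      using cong_sym[OF s(2)] sy by (simp add: cong_iff_dvd_diff of_nat_diff algebra_simps)
    then obtain j where j: "y - x - s = c * j" by auto
    have "j \<le> c * j" using c by simp
    also have "c * j \<le> \<Sum>F + L" using j y by auto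
    finally have "x + j * c \<in> subset_sums Q" using Q(2) by simp
    then have "x + j * c \<in> subset_sums U" using subset_sums_mono[OF Q(1)] by (rule rev_subsetD)
    then have "s + (x + j * c) \<in> subset_sums (F \<union> U)" by (rule subset_sums_add[OF s(1) _ F(2)])
    moreover have "s + (x + j * c) = y" using j sy by (simp add: mult.commute)
    ultimately show ?thesis by simp
  qed
  then show ?thesis by blast
qed

section \<open>Values of rational polynomials\<close>

text \<open>With \<open>m\<close> a common denominator of the coefficients, \<open>m D\<close> has integer coefficients, so \<open>x - y\<close> divides
\<open>m D(x) - m D(y)\<close>.  In particular an integer-valued polynomial is periodic modulo every modulus.\<close>

lemma rat_poly_difference_divisible:
  fixes D :: "rat poly"
  shows "\<exists>m::int. m > 0 \<and> (\<forall>x::int. of_int m * poly D (of_int x) \<in> \<int>) \<and>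
    (\<forall>x y::int. \<exists>q::int. of_int m * (poly D (of_int x) - poly D (of_int y)) = of_int ((x - y) * q))"
proof (induction D)
  case 0
  show ?case by (intro exI[of _ 1]) (auto intro: exI[of _ 0])
next
  case (pCons a D)
  then obtain m where m: "m > 0" "\<And>x. of_int m * poly D (of_int x) \<in> \<int>"
    "\<And>x y. \<exists>q. of_int m * (poly D (of_int x) - poly D (of_int y)) = of_int ((x - y) * q)"
    by blast
  obtain u b where ub: "b > 0" "a = of_int u / of_int b"
    using quotient_of_div quotient_of_denom_pos by (metis surj_pair)
  have M: "of_int (m * b) * poly (pCons a D) (of_int x) =
      of_int (m * u) + of_int (b * x) * (of_int m * poly D (of_int x))" for x
    using ub by (simp add: field_simps)
  show ?case
  proof (rule exI[of _ "m * b"], intro conjI allI)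
    show "m * b > 0" using m ub by simp
    show "of_int (m * b) * poly (pCons a D) (of_int x) \<in> \<int>" for x
      unfolding M by (intro Ints_add Ints_mult m(2) Ints_of_int)
    fix x y :: int
    obtain q where q: "of_int m * (poly D (of_int x) - poly D (of_int y)) = of_int ((x - y) * q)"
      using m(3) by blast
    obtain z where z: "of_int m * poly D (of_int y) = of_int z"
      using m(2)[of y] by (auto elim: Ints_cases)
    have "of_int (m * b) * (poly (pCons a D) (of_int x) - poly (pCons a D) (of_int y)) =
        of_int (b * x) * (of_int m * (poly D (of_int x) - poly D (of_int y))) +
        of_int (b * (x - y)) * (of_int m * poly D (of_int y))"
      by (simp add: algebra_simps)
    also have "\<dots> = of_int ((x - y) * (b * x * q + b * z))"
      unfolding q z by (simp add: algebra_simps)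
    finally show "\<exists>q. of_int (m * b) * (poly (pCons a D) (of_int x) - poly (pCons a D) (of_int y)) =
        of_int ((x - y) * q)" by blast
  qed
qed

lemma rat_poly_eventually_nonzero:
  fixes D :: "rat poly"
  assumes "D \<noteq> 0"
  shows "eventually (\<lambda>n. poly D (of_nat n) \<noteq> 0) sequentially"
proof -
  have "finite (of_nat -` {x. poly D x = 0} :: nat set)"
    by (intro finite_vimageI poly_roots_finite assms inj_of_nat)
  then show ?thesis
    by (simp add: vimage_def cofinite_eq_sequentially[symmetric] eventually_cofinite)
qed

text \<open>Taking differences \<open>D(x + g) - D(x)\<close> lowers the degree, so repeated differences end in a nonzero
constant.  The step is doubled each time: the offsets for the difference polynomial are multiples of
\<open>2g\<close>, hence shifting them by \<open>g\<close> gives new ones, and no argument of \<open>D\<close> is used twice.\<close>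

lemma constant_signed_sum:
  fixes D :: "rat poly" and g :: nat
  assumes "D \<noteq> 0" "g > 0"
  shows "\<exists>c T s. c \<noteq> 0 \<and> finite T \<and> (\<forall>k\<in>T. g dvd k) \<and> 
    (\<forall>n. (\<Sum>k\<in>T. (if s k then 1 else -1) * poly D (of_nat (n + k))) = c)"
  using assms
proof (induction "degree D" arbitrary: D g rule: less_induct)
  case less
  show ?case
  proof (cases "degree D = 0")
    case True
    then obtain c where "D = [:c:]" by (auto elim: degree_eq_zeroE)
    then show ?thesis using less.prems
      by (intro exI[of _ c] exI[of _ "{0}"] exI[of _ "\<lambda>_. True"]) auto
  next
    case False
    define D' where "D' = D \<circ>\<^sub>p [:of_nat g, 1:] - D"
    have D': "poly D' (of_nat n) = poly D (of_nat (n + g)) - poly D (of_nat n)" for n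
      by (simp add: D'_def poly_pcompose add_ac)
    have deg: "degree (D \<circ>\<^sub>p [:of_nat g, 1:]) = degree D"
      by (simp add: degree_pcompose)
    have "lead_coeff (D \<circ>\<^sub>p [:of_nat g, 1:]) = lead_coeff D"
      by (subst lead_coeff_comp) auto
    then have "coeff D' (degree D) = 0" using deg by (simp add: D'_def)
    moreover have "degree D' \<le> degree D"
      unfolding D'_def by (rule degree_diff_le) (auto simp: deg)
    ultimately have lt: "degree D' < degree D"
      using False by (metis le_neq_implies_less leading_coeff_0_iff degree_0)
    have "D' \<noteq> 0"
    proof
      assume "D' = 0"
      then have st: "poly D (of_nat (n + g)) = poly D (of_nat n)" for n using D'[of n] by simp
      have "poly D (of_nat (j * g)) = poly D 0" for j
      proof (induction j)
        case (Suc j)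
        then show ?case using st[of "j * g"] by (simp add: add.commute)
      qed simp
      \<comment> \<open>A polynomial taking one value infinitely often is constant.\<close>
      then have "range (\<lambda>j. of_nat (j * g)) \<subseteq> {x. poly (D - [:poly D 0:]) x = 0}" by auto
      moreover have "infinite (range (\<lambda>j. of_nat (j * g) :: rat))"
        using less.prems by (intro range_inj_infinite injI) simp
      ultimately have "infinite {x. poly (D - [:poly D 0:]) x = 0}" using finite_subset by blast
      then have "D = [:poly D 0:]" using poly_roots_finite[of "D - [:poly D 0:]"] by auto
      then show False using False by (metis degree_pCons_0)
    qed
    then obtain c T s where c: "c \<noteq> 0" and T: "finite T" "\<And>k. k \<in> T \<Longrightarrow> 2 * g dvd k"
      and sum: "\<And>n. (\<Sum>k\<in>T. (if s k then 1 else -1) * poly D' (of_nat (n + k))) = c"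
      using less.hyps[OF lt, of "2 * g"] less.prems by auto
    define T' where "T' = T \<union> (\<lambda>k. k + g) ` T"
    define s' where "s' k = (if k \<in> T then \<not> s k else s (k - g))" for k
    have notin: "k + g \<notin> T" if "k \<in> T" for k
    proof
      assume "k + g \<in> T"
      then have "2 * g dvd (k + g) - k" using T(2) that by (intro dvd_diff_nat) auto
      then have "2 * g dvd g" by simp
      then show False using less.prems by (auto dest: dvd_imp_le)
    qed
    have "(\<Sum>k\<in>T'. (if s' k then 1 else -1) * poly D (of_nat (n + k))) = c" for n
    proof -
      have "(\<Sum>k\<in>T'. (if s' k then 1 else -1) * poly D (of_nat (n + k))) =
        (\<Sum>k\<in>T. (if s' k then 1 else -1) * poly D (of_nat (n + k))) +
        (\<Sum>k\<in>(\<lambda>k. k + g) ` T. (if s' k then 1 else -1) * poly D (of_nat (n + k)))"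
        unfolding T'_def using T notin by (intro sum.union_disjoint) auto
      also have "(\<Sum>k\<in>T. (if s' k then 1 else -1) * poly D (of_nat (n + k))) =
        (\<Sum>k\<in>T. - ((if s k then 1 else -1) * poly D (of_nat (n + k))))"
        by (intro sum.cong) (auto simp: s'_def)
      also have "(\<Sum>k\<in>(\<lambda>k. k + g) ` T. (if s' k then 1 else -1) * poly D (of_nat (n + k))) =
        (\<Sum>k\<in>T. (if s k then 1 else -1) * poly D (of_nat (n + k + g)))"
        using notin by (subst sum.reindex) (auto simp: s'_def add_ac intro!: sum.cong)
      also have "(\<Sum>k\<in>T. - ((if s k then 1 else -1) * poly D (of_nat (n + k)))) + \<dots> = 
        (\<Sum>k\<in>T. (if s k then 1 else -1) * poly D' (of_nat (n + k)))"
        unfolding sum.distrib[symmetric] by (intro sum.cong refl) (simp only: D', simp add: algebra_simps)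
      finally show ?thesis using sum by simp
    qed
    moreover have "g dvd k" if "k \<in> T'" for k
      using that dvd_mult_right[OF T(2)] unfolding T'_def by auto
    ultimately show ?thesis using c T(1)
      by (intro exI[of _ c] exI[of _ T'] exI[of _ s']) (auto simp: T'_def)
  qed
qed

text \<open>The factor \<open>n\<^sup>j\<close> is what lets the induction over the coefficients go through.\<close>

lemma rat_poly_negligible:
  fixes P :: "rat poly" and \<alpha> :: real
  assumes "\<alpha> > 1"
  shows "(\<lambda>n. real n ^ j * (real_of_rat (poly P (of_nat n)) / \<alpha> ^ n)) \<longlonglongrightarrow> 0"
proof (induction P arbitrary: j)
  case 0
  show ?case by simp
next
  case (pCons a P)
  have "(\<lambda>n. real n ^ j / \<alpha> ^ n) \<longlonglongrightarrow> 0"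
    using assms by real_asymp
  then have "(\<lambda>n. real_of_rat a * (real n ^ j / \<alpha> ^ n) +
      real n ^ Suc j * (real_of_rat (poly P (of_nat n)) / \<alpha> ^ n)) \<longlonglongrightarrow> real_of_rat a * 0 + 0"
    by (intro tendsto_intros pCons.IH)
  then show ?case
    by (simp add: of_rat_add of_rat_mult ring_distribs add_divide_distrib mult_ac)
qed

text \<open>Integer values of a rational polynomial are periodic modulo \<open>p\<close>, with \<open>p\<close> times a common denominator
as a period.\<close>

lemma rat_poly_nondivisible_recurs:
  fixes D :: "rat poly" and p :: nat
  assumes p: "p > 0" and D: "\<And>n::int. poly D (of_int n) = of_int (v n)" and m: "\<not> int p dvd v m"
  shows "\<exists>n\<ge>N. \<not> int p dvd v (int n)"
proof -
  obtain M :: int where M: "M > 0"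
    and dvd: "\<And>x y::int. \<exists>q::int. of_int M * (poly D (of_int x) - poly D (of_int y)) = of_int ((x - y) * q)"
    using rat_poly_difference_divisible by blast
  \<comment> \<open>The number of periods is chosen so that \<open>n \<ge> N\<close> even for negative \<open>m\<close>.\<close>
  define n where "n = m + M * int p * (\<bar>m\<bar> + int N)"
  obtain q where "rat_of_int (M * (v n - v m)) = rat_of_int ((n - m) * q)"
    using dvd[of n m] by (auto simp: D)
  then have "M * (v n - v m) = (n - m) * q" by (simp only: of_int_eq_iff)
  also have "\<dots> = M * (int p * ((\<bar>m\<bar> + int N) * q))" by (simp add: n_def)
  finally have "v n - v m = int p * ((\<bar>m\<bar> + int N) * q)" using M by simp
  then have nd: "\<not> int p dvd v n" using m by (metis dvd_diff_right_iff dvd_triv_left)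
  have "1 \<le> M * int p" using M p by (simp add: int_one_le_iff_zero_less)
  then have "1 * (\<bar>m\<bar> + int N) \<le> M * int p * (\<bar>m\<bar> + int N)" by (intro mult_right_mono) auto
  then have "m + (\<bar>m\<bar> + int N) \<le> n" unfolding n_def by simp
  then have "n \<ge> int N" by linarith
  then show ?thesis using nd by (intro exI[of _ "nat n"]) auto
qed

section \<open>Growth of the levels\<close>

text \<open>The number \<open>\<alpha>\<^sub>k\<close> is the positive root of \<open>x\<^sup>2 - (k - 1)x - 2\<close>, so \<open>\<alpha> < \<alpha>\<^sub>k\<close> amounts to
\<open>k/(\<alpha> - 1) - 2/\<alpha> > 1\<close>.  This is the limiting case \<open>\<epsilon> \<rightarrow> 0\<close>, \<open>g \<rightarrow> \<infinity>\<close> of the last inequality.  The condition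
\<open>1 + \<epsilon> < \<alpha>(1 - \<epsilon>)\<close> separates consecutive levels.\<close>

lemma growth_constants:
  fixes \<alpha> :: real
  assumes k: "k \<ge> 2" and \<alpha>: "1 < \<alpha>" "\<alpha> < alpha_bound k"
  shows "\<exists>\<epsilon> g. 0 < \<epsilon> \<and> \<epsilon> < 1 \<and> g > 0 \<and> 1 + \<epsilon> < \<alpha> * (1 - \<epsilon>) \<and>
    1 + \<epsilon> \<le> (1 - \<epsilon>) * (k / (\<alpha> - 1) - 2 / (\<alpha> * (1 - (1/\<alpha>) ^ g)))"
proof -
  define s where "s = sqrt ((real k - 1)\<^sup>2 + 8)"
  have s: "s\<^sup>2 = (real k - 1)\<^sup>2 + 8" "s > real k - 1"
    by (auto simp: s_def intro: real_less_rsqrt)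
  have "(\<alpha> - (real k - 1 + s) / 2) * (\<alpha> - (real k - 1 - s) / 2) < 0"
    using \<alpha> s(2) by (intro mult_neg_pos) (auto simp: alpha_bound_def s_def field_simps)
  moreover have "(\<alpha> - (real k - 1 + s) / 2) * (\<alpha> - (real k - 1 - s) / 2) = 
      \<alpha>\<^sup>2 - (real k - 1) * \<alpha> + ((real k - 1)\<^sup>2 - s\<^sup>2) / 4"
    by (simp add: field_simps power2_eq_square)
  ultimately have "\<alpha>\<^sup>2 < (real k - 1) * \<alpha> + 2" using s(1) by simp
  then have lim_pos: "real k / (\<alpha> - 1) - 2 / \<alpha> - 1 > 0"
    using \<alpha> by (simp add: field_simps power2_eq_square)
  have e: "(\<lambda>n. 1 / real (n + 2)) \<longlonglongrightarrow> 0" by real_asymp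
  have p: "(\<lambda>n. (1/\<alpha>) ^ n) \<longlonglongrightarrow> 0" using \<alpha> by (intro LIMSEQ_power_zero) auto
  have "(\<lambda>n. (1 - 1 / real (n + 2)) * (k / (\<alpha> - 1) - 2 / (\<alpha> * (1 - (1/\<alpha>) ^ n))) - (1 + 1 / real (n + 2)))
      \<longlonglongrightarrow> (1 - 0) * (k / (\<alpha> - 1) - 2 / (\<alpha> * (1 - 0))) - (1 + 0)"
    using \<alpha> by (intro tendsto_intros e p) auto
  then have ev1: "eventually (\<lambda>n. (1 - 1 / real (n + 2)) * (k / (\<alpha> - 1) - 2 / (\<alpha> * (1 - (1/\<alpha>) ^ n))) - (1 + 1 / real (n + 2)) > 0) sequentially"
    using lim_pos by (intro order_tendstoD(1)) auto
  have "(\<lambda>n. \<alpha> * (1 - 1 / real (n + 2)) - (1 + 1 / real (n + 2))) \<longlonglongrightarrow> \<alpha> * (1 - 0) - (1 + 0)"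
    by (intro tendsto_intros e)
  then have ev2: "eventually (\<lambda>n. \<alpha> * (1 - 1 / real (n + 2)) - (1 + 1 / real (n + 2)) > 0) sequentially"
    using \<alpha> by (intro order_tendstoD(1)) auto
  have "eventually (\<lambda>n::nat. n > 0) sequentially" by (rule eventually_gt_at_top)
  with ev1 ev2 have "eventually (\<lambda>n::nat. n > 0 \<and> 
     \<alpha> * (1 - 1 / real (n + 2)) - (1 + 1 / real (n + 2)) > 0 \<and>
    (1 - 1 / real (n + 2)) * (k / (\<alpha> - 1) - 2 / (\<alpha> * (1 - (1/\<alpha>) ^ n))) - (1 + 1 / real (n + 2)) > 0) sequentially"
    by eventually_elim blast
  then obtain n where "n > 0 \<and> 
     \<alpha> * (1 - 1 / real (n + 2)) - (1 + 1 / real (n + 2)) > 0 \<and>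
    (1 - 1 / real (n + 2)) * (k / (\<alpha> - 1) - 2 / (\<alpha> * (1 - (1/\<alpha>) ^ n))) - (1 + 1 / real (n + 2)) > 0"
    using eventually_happens trivial_limit_sequentially by blast
  then show ?thesis
    by (intro exI[of _ "1 / real (n + 2)"] exI[of _ n]) auto
qed

text \<open>The sum is dominated by its largest term, which is at most \<open>\<alpha>\<^sup>n\<^sup>-\<^sup>1\<close>, up to the factor \<open>1/(1 - \<alpha>\<^sup>-\<^sup>g)\<close> of the
geometric series with ratio \<open>\<alpha>\<^sup>-\<^sup>g\<close>.\<close>

lemma sum_powers_multiples_le:
  fixes \<alpha> :: real
  assumes \<alpha>: "1 < \<alpha>" and g: "g > 0"
  shows "(\<Sum>m | m < n \<and> g dvd m. \<alpha> ^ m) \<le> \<alpha> ^ n / (\<alpha> * (1 - (1/\<alpha>) ^ g))"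
proof -
  define K where "K = 1 / (1 - (1/\<alpha>) ^ g)"
  have "(1/\<alpha>) ^ g < 1" using \<alpha> g by (simp add: power_less_one_iff)
  then have "K * (1 - (1/\<alpha>) ^ g) = 1" "K > 0" by (auto simp: K_def)
  then have K: "K = 1 + K * (1/\<alpha>) ^ g" "K > 0" by (auto simp: algebra_simps)
  \<comment> \<open>Here \<open>g * (n div g)\<close> is the largest multiple of \<open>g\<close> up to \<open>n\<close>; the bound reproduces itself because
    \<open>K = 1 + K\<alpha>\<^sup>-\<^sup>g\<close>.\<close>
  have *: "(\<Sum>m | m \<le> n \<and> g dvd m. \<alpha> ^ m) \<le> K * \<alpha> ^ (g * (n div g))" for n
  proof (induction n)
    case 0
    have "{m. m \<le> (0::nat) \<and> g dvd m} = {0}" by auto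
    moreover have "K * (1/\<alpha>) ^ g \<ge> 0" using K(2) \<alpha> by simp
    then have "1 \<le> K" using K(1) by linarith
    ultimately show ?case by simp
  next
    case (Suc n)
    show ?case
    proof (cases "g dvd Suc n")
      case True
      then have "g * (Suc n div g) = Suc n" by simp
      moreover have "Suc n div g = Suc (n div g)" using True by (simp add: div_Suc mod_eq_0_iff_dvd)
      ultimately have div: "g * (Suc n div g) = Suc n" "g * (n div g) + g = Suc n" by simp_all
      have "{m. m \<le> Suc n \<and> g dvd m} = insert (Suc n) {m. m \<le> n \<and> g dvd m}"
        using True by (auto simp: le_Suc_eq)
      then have "(\<Sum>m | m \<le> Suc n \<and> g dvd m. \<alpha> ^ m) = \<alpha> ^ Suc n + (\<Sum>m | m \<le> n \<and> g dvd m. \<alpha> ^ m)"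
        by simp
      also have "\<dots> \<le> \<alpha> ^ Suc n + K * \<alpha> ^ (g * (n div g))" using Suc by simp
      also have "\<alpha> ^ (g * (n div g)) = (1/\<alpha>) ^ g * \<alpha> ^ Suc n"
        using \<alpha> unfolding div(2)[symmetric] by (simp add: power_add power_divide)
      also have "\<alpha> ^ Suc n + K * ((1/\<alpha>) ^ g * \<alpha> ^ Suc n) = (1 + K * (1/\<alpha>) ^ g) * \<alpha> ^ Suc n"
        by (simp add: algebra_simps)
      finally show ?thesis using K(1) div(1) by simp
    next
      case False
      have "{m. m \<le> Suc n \<and> g dvd m} = {m. m \<le> n \<and> g dvd m}"
        using False by (auto simp: le_Suc_eq)
      then show ?thesis using Suc False by (simp add: div_Suc mod_eq_0_iff_dvd)
    qed
  qed
  show ?thesis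
  proof (cases n)
    case 0
    then show ?thesis using \<alpha> \<open>(1/\<alpha>) ^ g < 1\<close> by simp
  next
    case (Suc n')
    have "(\<Sum>m | m < n \<and> g dvd m. \<alpha> ^ m) \<le> K * \<alpha> ^ (g * (n' div g))"
      using *[of n'] Suc by (simp add: less_Suc_eq_le)
    also have "\<dots> \<le> K * \<alpha> ^ n'"
      using \<alpha> K by (intro mult_left_mono power_increasing) auto
    also have "\<dots> = \<alpha> ^ n / (\<alpha> * (1 - (1/\<alpha>) ^ g))"
      using \<alpha> Suc by (simp add: K_def)
    finally show ?thesis .
  qed
qed

text \<open>A level \<open>m\<close> contributes about \<open>\<alpha>\<^sup>m\<close> for each of its \<open>k\<close> elements, except that two are missing when
\<open>g\<close> divides \<open>m\<close>.  The subtracted term is the price for starting at level \<open>n0\<close>; it does not depend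
on \<open>n\<close>.\<close>

lemma sum_depleted_levels_ge:
  fixes \<alpha> :: real
  assumes \<alpha>: "1 < \<alpha>" and g: "g > 0" and n: "n0 \<le> n"
  shows "(k / (\<alpha> - 1) - 2 / (\<alpha> * (1 - (1/\<alpha>) ^ g))) * \<alpha> ^ n - k * \<alpha> ^ n0 / (\<alpha> - 1)
     \<le> (\<Sum>m=n0..<n. (real k - (if g dvd m then 2 else 0)) * \<alpha> ^ m)"
proof -
  have "(\<Sum>m=n0..<n. (if g dvd m then \<alpha> ^ m else 0)) \<le> (\<Sum>m | m < n \<and> g dvd m. \<alpha> ^ m)"
    unfolding sum.inter_filter[OF finite_atLeastLessThan, symmetric]
    using \<alpha> by (intro sum_mono2) auto
  also have "\<dots> \<le> \<alpha> ^ n / (\<alpha> * (1 - (1/\<alpha>) ^ g))" by (rule sum_powers_multiples_le[OF \<alpha> g])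
  finally have 1: "(\<Sum>m=n0..<n. (if g dvd m then \<alpha> ^ m else 0)) \<le> \<alpha> ^ n / (\<alpha> * (1 - (1/\<alpha>) ^ g))" .
  have 2: "(\<Sum>m=n0..<n. \<alpha> ^ m) = (\<alpha> ^ n - \<alpha> ^ n0) / (\<alpha> - 1)"
    using n
  proof (induction n rule: dec_induct)
    case (step n)
    then show ?case using \<alpha> by (simp add: field_simps)
  qed simp
  have "(\<Sum>m=n0..<n. (real k - (if g dvd m then 2 else 0)) * \<alpha> ^ m) =
    k * (\<Sum>m=n0..<n. \<alpha> ^ m) - 2 * (\<Sum>m=n0..<n. (if g dvd m then \<alpha> ^ m else 0))"
    unfolding sum_distrib_left sum_subtractf[symmetric]
    by (intro sum.cong) (auto simp: algebra_simps)
  also have "\<dots> \<ge> k * ((\<alpha> ^ n - \<alpha> ^ n0) / (\<alpha> - 1)) - 2 * (\<alpha> ^ n / (\<alpha> * (1 - (1/\<alpha>) ^ g)))"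
    using 1 unfolding 2 by linarith
  finally show ?thesis by (simp add: algebra_simps diff_divide_distrib)
qed

section \<open>Completeness from exponentially growing levels\<close>

text \<open>Replacing \<open>b 2 m\<close> by \<open>b 1 m\<close> changes a sum by \<open>D(m)\<close>, and the opposite replacement by \<open>-D(m)\<close>.  Thus the
signed sum of values of \<open>D\<close> with constant value becomes a simultaneous exchange at several levels
whose total effect is the same \<open>c\<close> wherever it is placed.\<close>

lemma exchange_blocks:
  fixes b :: "nat \<Rightarrow> nat \<Rightarrow> nat" and D :: "rat poly"
  assumes "D \<noteq> 0" "g > 0"
    and D: "\<And>n. n \<ge> n0 \<Longrightarrow> rat_of_int (int (b 1 n) - int (b 2 n)) = poly D (of_nat n)"
    and mono: "\<And>m n i j. n0 \<le> m \<Longrightarrow> m < n \<Longrightarrow> i \<in> {1,2} \<Longrightarrow> j \<in> {1,2} \<Longrightarrow> b i m < b j n"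
  shows "\<exists>c::nat. c > 0 \<and> (\<forall>n\<ge>n0. g dvd n \<longrightarrow> (\<exists>X Y. finite X \<and> finite Y \<and>
     X \<union> Y \<subseteq> {b i m | i m. i \<in> {1,2} \<and> n \<le> m \<and> g dvd m} \<and> \<Sum>X = \<Sum>Y + c))"
proof -
  obtain c T s where c: "c \<noteq> 0" and T: "finite T" "\<And>k. k \<in> T \<Longrightarrow> g dvd k"
    and sum: "\<And>n. (\<Sum>k\<in>T. (if s k then 1 else -1) * poly D (of_nat (n + k))) = c"
    using constant_signed_sum[OF assms(1,2)] by metis
  define X where "X n = (\<lambda>k. b (if s k then 1 else 2) (n + k)) ` T" for n
  define Y where "Y n = (\<lambda>k. b (if s k then 2 else 1) (n + k)) ` T" for n
  have inj: "inj_on (\<lambda>k. b (f k) (n + k)) T" if "n \<ge> n0" "\<And>k. f k \<in> {1,2}" for n and f :: "nat \<Rightarrow> nat"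
  proof (rule linorder_inj_onI)
    fix x y :: nat assume "x < y"
    then have "b (f x) (n + x) < b (f y) (n + y)" using that by (intro mono) auto
    then show "b (f x) (n + x) \<noteq> b (f y) (n + y)" by simp
  qed auto
  have diff: "rat_of_int (int (\<Sum>(X n)) - int (\<Sum>(Y n))) = c" if n: "n \<ge> n0" for n
  proof -
    have "int (\<Sum>(X n)) - int (\<Sum>(Y n)) = 
       (\<Sum>k\<in>T. int (b (if s k then 1 else 2) (n + k)) - int (b (if s k then 2 else 1) (n + k)))"
      unfolding X_def Y_def using n
      by (subst (1 2) sum.reindex[OF inj]) (auto simp: sum_subtractf)
    also have "rat_of_int \<dots> = (\<Sum>k\<in>T. (if s k then 1 else -1) * rat_of_int (int (b 1 (n + k)) - int (b 2 (n + k))))"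
      unfolding of_int_sum by (intro sum.cong) auto
    also have "\<dots> = c" unfolding sum[of n, symmetric] using n
      by (intro sum.cong refl arg_cong2[where f = "(*)"] D) auto
    finally show ?thesis .
  qed
  define z where "z = int (\<Sum>(X n0)) - int (\<Sum>(Y n0))"
  have z: "rat_of_int z = c" using diff[of n0] by (simp add: z_def)
  then have dz: "int (\<Sum>(X n)) - int (\<Sum>(Y n)) = z" if "n \<ge> n0" for n
    using diff[OF that] by (metis of_int_eq_iff)
  have "z \<noteq> 0" using c z by auto
  have sub: "X n \<union> Y n \<subseteq> {b i m | i m. i \<in> {1,2} \<and> n \<le> m \<and> g dvd m}" if n: "g dvd n" for n
  proof -
    have "b i (n + k) \<in> {b i m | i m. i \<in> {1,2} \<and> n \<le> m \<and> g dvd m}"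
      if "k \<in> T" "i \<in> {1,2}" for i k
      using that n T(2) by (intro CollectI exI[of _ i] exI[of _ "n + k"]) simp
    then show ?thesis unfolding X_def Y_def by (intro Un_least image_subsetI) simp_all
  qed
  have fin: "finite (X n)" "finite (Y n)" for n using T(1) by (auto simp: X_def Y_def)
  have "\<exists>X Y. finite X \<and> finite Y \<and>
     X \<union> Y \<subseteq> {b i m | i m. i \<in> {1,2} \<and> n \<le> m \<and> g dvd m} \<and> \<Sum>X = \<Sum>Y + nat \<bar>z\<bar>"
    if n: "n \<ge> n0" "g dvd n" for n
  proof (cases "z > 0")
    case True
    then have "\<Sum>(X n) = \<Sum>(Y n) + nat \<bar>z\<bar>" using dz[OF n(1)] by linarith
    then show ?thesis using fin sub[OF n(2)] by (intro exI[of _ "X n"] exI[of _ "Y n"]) auto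
  next
    case False
    then have "\<Sum>(Y n) = \<Sum>(X n) + nat \<bar>z\<bar>" using dz[OF n(1)] by linarith
    then show ?thesis using fin sub[OF n(2)] by (intro exI[of _ "Y n"] exI[of _ "X n"]) auto
  qed
  then show ?thesis using \<open>z \<noteq> 0\<close> by (intro exI[of _ "nat \<bar>z\<bar>"]) auto
qed

text \<open>Here \<open>b i n\<close> is the \<open>i\<close>-th element of level \<open>n\<close>.  The order of the choices matters: first the spacing
\<open>g\<close>, then the exchange constant \<open>c\<close>, then \<open>F\<close> for the residues modulo \<open>c\<close>, then the level \<open>n2\<close>
beyond \<open>F\<close> at which everything else starts, and finally the length \<open>C\<close> of the interval to be built.\<close>

lemma complete_if_exponential_levels:
  fixes b :: "nat \<Rightarrow> nat \<Rightarrow> nat" and D :: "rat poly" and \<alpha> t :: real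
  assumes k: "k \<ge> 2" and t: "t > 0" and \<alpha>: "1 < \<alpha>" "\<alpha> < alpha_bound k"
    and approx: "\<And>\<epsilon>. \<epsilon> > 0 \<Longrightarrow>
       \<forall>\<^sub>F n in sequentially. \<forall>i\<in>{1..k}. \<bar>real (b i n) - t * \<alpha> ^ n\<bar> \<le> \<epsilon> * (t * \<alpha> ^ n)"
    and inj: "\<forall>\<^sub>F n in sequentially. inj_on (\<lambda>i. b i n) {1..k}"
    and D: "D \<noteq> 0"
       "\<forall>\<^sub>F n in sequentially. rat_of_int (int (b 1 n) - int (b 2 n)) = poly D (of_nat n)"
    and A: "\<forall>\<^sub>F n in sequentially. \<forall>i\<in>{1..k}. b i n \<in> A"
    and primes: "\<And>p. prime p \<Longrightarrow> infinite {a \<in> A. \<not> p dvd a}"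
  shows "complete_set A"
proof -
  obtain \<epsilon> g where \<epsilon>: "0 < \<epsilon>" "\<epsilon> < 1" "1 + \<epsilon> < \<alpha> * (1 - \<epsilon>)" and g: "g > 0"
    and growth: "1 + \<epsilon> \<le> (1 - \<epsilon>) * (k / (\<alpha> - 1) - 2 / (\<alpha> * (1 - (1/\<alpha>) ^ g)))"
    using growth_constants[OF k \<alpha>] by blast
  have "\<forall>\<^sub>F n in sequentially. (\<forall>i\<in>{1..k}. \<bar>real (b i n) - t * \<alpha> ^ n\<bar> \<le> \<epsilon> * (t * \<alpha> ^ n)) \<and>
     inj_on (\<lambda>i. b i n) {1..k} \<and> rat_of_int (int (b 1 n) - int (b 2 n)) = poly D (of_nat n) \<and>
     (\<forall>i\<in>{1..k}. b i n \<in> A)"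
    by (intro eventually_conj approx \<epsilon> inj D A)
  then obtain n1 where n1: "\<And>n i. n \<ge> n1 \<Longrightarrow> i \<in> {1..k} \<Longrightarrow> \<bar>real (b i n) - t * \<alpha> ^ n\<bar> \<le> \<epsilon> * (t * \<alpha> ^ n)"
    "\<And>n. n \<ge> n1 \<Longrightarrow> inj_on (\<lambda>i. b i n) {1..k}"
    "\<And>n. n \<ge> n1 \<Longrightarrow> rat_of_int (int (b 1 n) - int (b 2 n)) = poly D (of_nat n)"
    "\<And>n i. n \<ge> n1 \<Longrightarrow> i \<in> {1..k} \<Longrightarrow> b i n \<in> A"
    unfolding eventually_sequentially by blast
  have upper: "b i n \<le> (1 + \<epsilon>) * (t * \<alpha> ^ n)" and lower: "(1 - \<epsilon>) * (t * \<alpha> ^ n) \<le> b i n"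
    if "n \<ge> n1" "i \<in> {1..k}" for i n
    using n1(1)[OF that] by (auto simp: abs_le_iff algebra_simps)
  have mono: "b i m < b j n" if "n1 \<le> m" "m < n" "i \<in> {1..k}" "j \<in> {1..k}" for i j m n
  proof -
    have "real (b i m) \<le> (1 + \<epsilon>) * (t * \<alpha> ^ m)" using upper that by simp
    also have "\<dots> < (\<alpha> * (1 - \<epsilon>)) * (t * \<alpha> ^ m)" using \<epsilon> t \<alpha> by (intro mult_strict_right_mono) auto
    also have "\<dots> = (1 - \<epsilon>) * (t * \<alpha> ^ Suc m)" by simp
    also have "\<dots> \<le> (1 - \<epsilon>) * (t * \<alpha> ^ n)"
      using that \<epsilon> t \<alpha> by (intro mult_left_mono power_increasing) auto
    also have "\<dots> \<le> b j n" using lower that by simp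
    finally show ?thesis by simp
  qed
  have to_inf: "\<forall>\<^sub>F n in sequentially. N < (1 - \<epsilon>) * (t * \<alpha> ^ n)" for N
  proof -
    have "filterlim (\<lambda>n. \<alpha> ^ n) at_top sequentially" using \<alpha> by real_asymp
    then have "filterlim (\<lambda>n. ((1 - \<epsilon>) * t) * \<alpha> ^ n) at_top sequentially"
      using \<epsilon> t by (intro filterlim_tendsto_pos_mult_at_top[OF tendsto_const]) auto
    then show ?thesis by (simp add: filterlim_at_top_dense mult.assoc)
  qed
  have "\<exists>c::nat. c > 0 \<and> (\<forall>n\<ge>n1. g dvd n \<longrightarrow> (\<exists>X Y. finite X \<and> finite Y \<and>
     X \<union> Y \<subseteq> {b i m | i m. i \<in> {1,2} \<and> n \<le> m \<and> g dvd m} \<and> \<Sum>X = \<Sum>Y + c))"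
    by (rule exchange_blocks[OF D(1) g n1(3)]) (use mono k in auto)
  then obtain c where c: "c > 0" and blocks: "\<And>n. n \<ge> n1 \<Longrightarrow> g dvd n \<Longrightarrow> (\<exists>X Y. finite X \<and> finite Y \<and>
     X \<union> Y \<subseteq> {b i m | i m. i \<in> {1,2} \<and> n \<le> m \<and> g dvd m} \<and> \<Sum>X = \<Sum>Y + c)"
    by blast
  obtain F where F: "finite F" "F \<subseteq> A" "\<And>r::int. \<exists>s\<in>subset_sums F. [int s = r] (mod int c)"
    using subset_sums_cover_residues[OF c primes] by blast
  obtain n2 where n2: "n2 \<ge> n1" "\<And>n. n \<ge> n2 \<Longrightarrow> real (\<Sum>F) < (1 - \<epsilon>) * (t * \<alpha> ^ n)"
    using to_inf[of "real (\<Sum>F)"] unfolding eventually_sequentially by (metis linorder_linear order_trans)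
  \<comment> \<open>\<open>U\<close> is reserved for exchanges; \<open>E n\<close> is what remains of level \<open>n\<close>.\<close>
  define U where "U = {b i m | i m. i \<in> {1,2} \<and> n2 \<le> m \<and> g dvd m}"
  define idx where "idx n = (if g dvd n then {3..k} else {1..k})" for n
  define E where "E n = (\<lambda>i. b i n) ` idx n" for n
  define C where "C = nat \<lceil>(1 - \<epsilon>) * t * (k * \<alpha> ^ n2 / (\<alpha> - 1))\<rceil>"
  define h where "h n = nat \<lfloor>(1 + \<epsilon>) * (t * \<alpha> ^ n)\<rfloor>" for n
  have idx: "idx n \<subseteq> {1..k}" for n by (auto simp: idx_def)
  have notF: "b i n \<notin> F" if "n \<ge> n2" "i \<in> {1..k}" for i n
  proof
    assume "b i n \<in> F"
    then have "b i n \<le> \<Sum>F" using member_le_sum[of "b i n" F "\<lambda>x. x"] F(1) by simp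
    moreover have "real (\<Sum>F) < b i n" using n2(2)[OF that(1)] lower[of n i] that n2(1) by linarith
    ultimately show False by simp
  qed
  have "\<exists>x. {x..x + C} \<subseteq> subset_sums (F \<union> U)"
  proof (rule exchanges_give_interval[OF c F(1) _ F(3)])
    show "F \<inter> U = {}" using notF k by (auto simp: U_def)
    fix N
    obtain n3 where n3: "n3 \<ge> n2" "\<And>n. n \<ge> n3 \<Longrightarrow> real N < (1 - \<epsilon>) * (t * \<alpha> ^ n)"
      using to_inf[of "real N"] unfolding eventually_sequentially by (metis linorder_linear order_trans)
    have "g * n3 \<ge> n3" using g by simp
    then have "g * n3 \<ge> n1" using n3(1) n2(1) by linarith
    then have "\<exists>X Y. finite X \<and> finite Y \<and>
        X \<union> Y \<subseteq> {b i m | i m. i \<in> {1,2} \<and> g * n3 \<le> m \<and> g dvd m} \<and> \<Sum>X = \<Sum>Y + c"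
      by (rule blocks) simp
    then obtain X Y where XY: "finite X" "finite Y"
      "X \<union> Y \<subseteq> {b i m | i m. i \<in> {1,2} \<and> g * n3 \<le> m \<and> g dvd m}" "\<Sum>X = \<Sum>Y + c"
      by (elim exE conjE)
    have "u \<in> U \<and> N < u" if "u \<in> X \<union> Y" for u
    proof -
      obtain i m where im: "u = b i m" "i \<in> {1,2}" "g * n3 \<le> m" "g dvd m" using XY(3) \<open>u \<in> X \<union> Y\<close> by blast
      have m: "m \<ge> n3" "m \<ge> n2" "m \<ge> n1" using im(3) \<open>g * n3 \<ge> n3\<close> n3(1) n2(1) by linarith+
      have "i \<in> {1..k}" using im(2) k by auto
      then have "real N < b i m" using lower[OF m(3)] n3(2)[OF m(1)] by fastforce
      moreover have "u \<in> U" unfolding U_def using im m(2) by blast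
      ultimately show ?thesis using im(1) by simp
    qed
    then show "\<exists>X Y. finite X \<and> finite Y \<and> X \<subseteq> U \<and> Y \<subseteq> U \<and> (\<forall>u\<in>X \<union> Y. N < u) \<and> \<Sum>X = \<Sum>Y + c"
      using XY by (intro exI[of _ X] exI[of _ Y]) auto
  qed
  then obtain x where x: "{x..x + C} \<subseteq> subset_sums (F \<union> U)" by blast
  have "{x..} \<subseteq> subset_sums (F \<union> U \<union> (\<Union>n\<in>{n2..}. E n))"
  proof (rule subset_sums_fill_levels[OF x])
    show "finite (E n)" for n by (simp add: E_def idx_def)
    show "E m \<inter> E n = {}" if "n2 \<le> m" "m < n" for m n
    proof -
      have "e < e'" if em: "e \<in> E m" "e' \<in> E n" for e e'
      proof -
        obtain i j where "e = b i m" "i \<in> {1..k}" "e' = b j n" "j \<in> {1..k}"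
          using em idx unfolding E_def by blast
        then show ?thesis using mono \<open>n2 \<le> m\<close> \<open>m < n\<close> n2(1) by simp
      qed
      then show ?thesis by fastforce
    qed
    show "e \<le> h n" if ne: "n2 \<le> n" "e \<in> E n" for n e
    proof -
      obtain i where "e = b i n" "i \<in> {1..k}" using ne(2) idx unfolding E_def by blast
      then have "real e \<le> (1 + \<epsilon>) * (t * \<alpha> ^ n)" using upper ne(1) n2(1) by simp
      then show ?thesis unfolding h_def by (rule le_nat_floor)
    qed
    show "\<exists>n\<ge>n2. N \<le> h n" for N
    proof -
      have "\<forall>\<^sub>F n in sequentially. n \<ge> n2 \<and> real N < (1 - \<epsilon>) * (t * \<alpha> ^ n)"
        by (intro eventually_conj to_inf eventually_ge_at_top)
      then obtain n where n: "n \<ge> n2" "real N < (1 - \<epsilon>) * (t * \<alpha> ^ n)"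
        using eventually_happens'[OF trivial_limit_sequentially] by blast
      have "(1 - \<epsilon>) * (t * \<alpha> ^ n) \<le> (1 + \<epsilon>) * (t * \<alpha> ^ n)"
        using \<epsilon> t \<alpha> by (intro mult_right_mono) auto
      then have "N \<le> h n" using n(2) unfolding h_def by (intro le_nat_floor) linarith
      then show ?thesis using n(1) by blast
    qed
    show "E n \<inter> (F \<union> U) = {}" if n: "n2 \<le> n" for n
    proof -
      have "b i n \<notin> U" if i: "i \<in> idx n" for i
      proof
        assume "b i n \<in> U"
        then obtain j m where jm: "b i n = b j m" "j \<in> {1,2}" "n2 \<le> m" "g dvd m" by (auto simp: U_def)
        have ij: "i \<in> {1..k}" "j \<in> {1..k}"
          using subsetD[OF idx i] jm(2) k by auto
        have "m = n"
          using mono[of m n j i] mono[of n m i j] ij jm(1,3) n n2(1) by (cases rule: linorder_cases[of m n]) simp_all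
        then have "i = j" using n1(2)[of n] n n2(1) ij jm(1) inj_onD[of "\<lambda>i. b i n" "{1..k}" i j] by simp
        then show False using i jm(2,4) \<open>m = n\<close> by (auto simp: idx_def)
      qed
      moreover have "b i n \<notin> F" if i: "i \<in> idx n" for i
        using notF[OF n] subsetD[OF idx i] by blast
      ultimately show ?thesis by (auto simp: E_def)
    qed
    show "h n \<le> C + (\<Sum>m=n2..<n. \<Sum>(E m))" if n: "n2 \<le> n" for n
    proof -
      have Em: "(1 - \<epsilon>) * t * ((real k - (if g dvd m then 2 else 0)) * \<alpha> ^ m) \<le> real (\<Sum>(E m))"
        if m: "m \<ge> n2" for m
      proof -
        have "real (card (idx m)) = real k - (if g dvd m then 2 else 0)"
          using k by (auto simp: idx_def of_nat_diff)
        then have "(1 - \<epsilon>) * t * ((real k - (if g dvd m then 2 else 0)) * \<alpha> ^ m) =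
            (\<Sum>i\<in>idx m. (1 - \<epsilon>) * (t * \<alpha> ^ m))" by simp
        also have "\<dots> \<le> (\<Sum>i\<in>idx m. real (b i m))"
          using subsetD[OF idx] m n2(1) by (intro sum_mono lower) auto
        also have "\<dots> = real (\<Sum>(E m))"
          unfolding E_def using inj_on_subset[OF n1(2) idx, of m] m n2(1) by (simp add: sum.reindex)
        finally show ?thesis .
      qed
      have "(1 + \<epsilon>) * (t * \<alpha> ^ n) \<le>
         (1 - \<epsilon>) * (k / (\<alpha> - 1) - 2 / (\<alpha> * (1 - (1/\<alpha>) ^ g))) * (t * \<alpha> ^ n)"
        using growth t \<alpha> by (intro mult_right_mono) auto
      also have "\<dots> = (1 - \<epsilon>) * t * (k * \<alpha> ^ n2 / (\<alpha> - 1)) +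
         (1 - \<epsilon>) * t * ((k / (\<alpha> - 1) - 2 / (\<alpha> * (1 - (1/\<alpha>) ^ g))) * \<alpha> ^ n - k * \<alpha> ^ n2 / (\<alpha> - 1))"
        by (simp add: algebra_simps)
      also have "\<dots> \<le> real C +
         (1 - \<epsilon>) * t * (\<Sum>m=n2..<n. (real k - (if g dvd m then 2 else 0)) * \<alpha> ^ m)"
        using \<epsilon> t unfolding C_def
        by (intro add_mono mult_left_mono sum_depleted_levels_ge[OF \<alpha>(1) g n] real_nat_ceiling_ge) auto
      also have "\<dots> \<le> real C + (\<Sum>m=n2..<n. real (\<Sum>(E m)))"
        unfolding sum_distrib_left using Em by (intro add_mono sum_mono) auto
      also have "\<dots> = real (C + (\<Sum>m=n2..<n. \<Sum>(E m)))" by simp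
      finally show ?thesis unfolding h_def by linarith
    qed
  qed
  moreover have "F \<union> U \<union> (\<Union>n\<in>{n2..}. E n) \<subseteq> A"
  proof (intro Un_least UN_least F(2))
    show "U \<subseteq> A" using n1(4) n2(1) k by (auto simp: U_def)
    show "E n \<subseteq> A" if "n \<in> {n2..}" for n
      unfolding E_def using n1(4) n2(1) subsetD[OF idx] that by (intro image_subsetI) auto
  qed
  then have "subset_sums (F \<union> U \<union> (\<Union>n\<in>{n2..}. E n)) \<subseteq> subset_sums A" by (rule subset_sums_mono)
  ultimately show ?thesis
    unfolding complete_set_iff_subset_sums by (intro exI[of _ x]) (rule order_trans)
qed

section \<open>Distance to the nearest integer\<close>

lemma dist_nearest_int_le: "dist_nearest_int x \<le> \<bar>x - of_int m\<bar>"
  unfolding dist_nearest_int_def by (rule round_diff_minimal)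

lemma dist_nearest_int_nonneg: "dist_nearest_int x \<ge> 0"
  by (simp add: dist_nearest_int_def)

lemma dist_nearest_int_of_int [simp]: "dist_nearest_int (of_int m) = 0"
  by (simp add: dist_nearest_int_def)

lemma dist_nearest_int_pos: "x \<notin> \<int> \<Longrightarrow> dist_nearest_int x > 0"
  unfolding dist_nearest_int_def by (metis Ints_of_int eq_iff_diff_eq_0 zero_less_abs_iff)

lemma dist_nearest_int_add_le: "dist_nearest_int (x + y) \<le> dist_nearest_int x + dist_nearest_int y"
  using dist_nearest_int_le[of "x + y" "round x + round y"]
  by (simp add: dist_nearest_int_def)

lemma dist_nearest_int_diff_le: "dist_nearest_int (x - y) \<le> dist_nearest_int x + dist_nearest_int y"
  using dist_nearest_int_le[of "x - y" "round x - round y"]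
  by (simp add: dist_nearest_int_def)

lemma dist_nearest_int_sum_le: "dist_nearest_int (sum f S) \<le> (\<Sum>a\<in>S. dist_nearest_int (f a))"
proof (induction S rule: infinite_finite_induct)
  case (insert a S)
  then show ?case using dist_nearest_int_add_le[of "f a" "sum f S"] by simp
qed (use dist_nearest_int_of_int[of 0] in simp_all)

text \<open>A finite total leaves a finite set outside which the terms sum to less than \<open>\<parallel>\<theta>\<parallel>/2\<close>.  As \<open>\<parallel>\<cdot>\<parallel>\<close> is
subadditive, every large \<open>n\<close>, being a sum of distinct elements outside that set, has
\<open>\<parallel>n\<theta>\<parallel> < \<parallel>\<theta>\<parallel>/2\<close>; this is absurd for \<open>n\<close> and \<open>n + 1\<close> together.\<close>

lemma strongly_complete_imp_divergent:
  assumes sc: "strongly_complete A" and \<theta>: "\<theta> \<notin> \<int>"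
  shows "(\<Sum>\<^sub>\<infinity>a\<in>A. ennreal (dist_nearest_int (real a * \<theta>))) = \<infinity>"
proof (rule ccontr)
  define f where "f a = dist_nearest_int (real a * \<theta>)" for a
  define d where "d = dist_nearest_int \<theta>"
  have d: "d > 0" using dist_nearest_int_pos[OF \<theta>] by (simp add: d_def)
  have f0: "f a \<ge> 0" for a by (simp add: f_def dist_nearest_int_nonneg)
  assume "(\<Sum>\<^sub>\<infinity>a\<in>A. ennreal (dist_nearest_int (real a * \<theta>))) \<noteq> \<infinity>"
  then have fin: "(SUP F\<in>{F. finite F \<and> F \<subseteq> A}. \<Sum>a\<in>F. ennreal (f a)) \<noteq> \<infinity>"
    by (simp add: nonneg_infsum_complete f_def)
  have "\<exists>F\<in>{F. finite F \<and> F \<subseteq> A}. (SUP F\<in>{F. finite F \<and> F \<subseteq> A}. \<Sum>a\<in>F. ennreal (f a)) <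
      (\<Sum>a\<in>F. ennreal (f a)) + ennreal (d / 2)"
    by (rule SUP_approx_ennreal) (use fin d in auto)
  then obtain F where F: "finite F" "F \<subseteq> A"
    and less: "(SUP F\<in>{F. finite F \<and> F \<subseteq> A}. \<Sum>a\<in>F. ennreal (f a)) < (\<Sum>a\<in>F. ennreal (f a)) + ennreal (d / 2)"
    by blast
  have tail: "sum f G < d / 2" if G: "finite G" "G \<subseteq> A - F" for G
  proof -
    have "(\<Sum>a\<in>F \<union> G. ennreal (f a)) \<le> (SUP F\<in>{F. finite F \<and> F \<subseteq> A}. \<Sum>a\<in>F. ennreal (f a))"
      using F G by (intro SUP_upper) auto
    also note less
    also have "(\<Sum>a\<in>F. ennreal (f a)) + ennreal (d / 2) = ennreal (sum f F + d / 2)"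
      using f0 d by (simp add: sum_ennreal sum_nonneg)
    also have "(\<Sum>a\<in>F \<union> G. ennreal (f a)) = ennreal (sum f F + sum f G)"
      using f0 F G by (subst sum_ennreal) (auto intro!: arg_cong[where f = ennreal] sum.union_disjoint)
    finally show ?thesis using f0 by (subst (asm) ennreal_less_iff) (auto intro!: add_nonneg_nonneg sum_nonneg)
  qed
  have "complete_set (A - F)" using sc F unfolding strongly_complete_def by blast
  then obtain N where N: "\<And>n. n \<ge> N \<Longrightarrow> \<exists>G. finite G \<and> G \<subseteq> A - F \<and> n = \<Sum>G"
    unfolding complete_set_def by blast
  have small: "f n < d / 2" if n: "n \<ge> N" for n
  proof -
    obtain G where G: "finite G" "G \<subseteq> A - F" "n = \<Sum>G" using N[OF n] by blast
    have "f n = dist_nearest_int (\<Sum>a\<in>G. real a * \<theta>)"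
      using G(3) by (simp add: f_def sum_distrib_right)
    also have "\<dots> \<le> sum f G" unfolding f_def by (rule dist_nearest_int_sum_le)
    also have "\<dots> < d / 2" by (rule tail[OF G(1,2)])
    finally show ?thesis .
  qed
  have "d = dist_nearest_int (real (Suc N) * \<theta> - real N * \<theta>)"
    by (simp add: d_def algebra_simps)
  also have "\<dots> \<le> f (Suc N) + f N" unfolding f_def by (rule dist_nearest_int_diff_le)
  also have "\<dots> < d" using small[of N] small[of "Suc N"] by simp
  finally show False by simp
qed

text \<open>At \<open>\<theta> = 1/p\<close> the multiples of \<open>p\<close> contribute nothing to the sum.\<close>

lemma divergent_imp_infinite_nondivisible:
  assumes p: "prime p"
    and div: "\<And>\<theta>::real. \<theta> \<notin> \<int> \<Longrightarrow> (\<Sum>\<^sub>\<infinity>a\<in>A. ennreal (dist_nearest_int (real a * \<theta>))) = \<infinity>"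
  shows "infinite {a \<in> A. \<not> p dvd a}"
proof
  assume fin: "finite {a \<in> A. \<not> p dvd a}"
  have p1: "p > 1" using p by (rule prime_gt_1_nat)
  have "1 / real p \<notin> \<int>"
  proof
    assume "1 / real p \<in> \<int>"
    then obtain z where "1 / real p = of_int z" by (auto elim: Ints_cases)
    moreover have "0 < 1 / real p" "1 / real p < 1" using p1 by auto
    ultimately have "0 < real_of_int z" "real_of_int z < 1" by simp_all
    then show False by simp
  qed
  have zero: "dist_nearest_int (real a / real p) = 0" if pa: "p dvd a" for a
  proof -
    obtain q where "a = p * q" using pa by (rule dvdE)
    then have "real a / real p = of_int (int q)" using p1 by simp
    then show ?thesis by (simp only: dist_nearest_int_of_int)
  qed
  have "(\<Sum>\<^sub>\<infinity>a\<in>A. ennreal (dist_nearest_int (real a * (1 / real p)))) =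
     (\<Sum>\<^sub>\<infinity>a\<in>{a \<in> A. \<not> p dvd a}. ennreal (dist_nearest_int (real a * (1 / real p))))"
    by (intro infsum_cong_neutral) (auto simp: zero)
  also have "\<dots> < \<infinity>" using fin by (simp add: sum_ennreal dist_nearest_int_nonneg)
  finally show False using div[OF \<open>1 / real p \<notin> \<int>\<close>] by simp
qed

section \<open>Equivalence of the three conditions\<close>

lemma seq_term_asymp:
  assumes P: "P \<in> int_valued_polys" and t: "t > 0" and \<alpha>: "\<alpha> > 1" and \<epsilon>: "\<epsilon> > 0"
  shows "\<forall>\<^sub>F n in sequentially. \<bar>real (nat (seq_term t \<alpha> P n)) - t * \<alpha> ^ n\<bar> \<le> \<epsilon> * (t * \<alpha> ^ n)"
proof -
  have val: "real_of_int (int_poly_val P (int n)) = real_of_rat (poly P (of_nat n))" for n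
    using of_int_int_poly_val[OF P, of "int n"] by (metis of_int_of_nat_eq of_rat_of_int_eq)
  have "(\<lambda>n. \<bar>real n ^ 0 * (real_of_rat (poly P (of_nat n)) / \<alpha> ^ n)\<bar>) \<longlonglongrightarrow> 0"
    by (intro tendsto_rabs_zero rat_poly_negligible \<alpha>)
  then have "\<forall>\<^sub>F n in sequentially. \<bar>real n ^ 0 * (real_of_rat (poly P (of_nat n)) / \<alpha> ^ n)\<bar> < \<epsilon> * t / 2"
    using \<epsilon> t by (intro order_tendstoD(2)) auto
  moreover have "(\<lambda>n. 1 / \<alpha> ^ n) \<longlonglongrightarrow> 0" using \<alpha> by real_asymp
  then have "\<forall>\<^sub>F n in sequentially. 1 / \<alpha> ^ n < \<epsilon> * t / 2"
    using \<epsilon> t by (intro order_tendstoD(2)) auto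
  ultimately show ?thesis
  proof eventually_elim
    case (elim n)
    have pos: "\<alpha> ^ n > 0" using \<alpha> by simp
    have "\<bar>real_of_int (int_poly_val P (int n))\<bar> < \<epsilon> * t / 2 * \<alpha> ^ n" "1 < \<epsilon> * t / 2 * \<alpha> ^ n"
      using elim pos by (auto simp: val abs_mult field_simps)
    moreover have "\<bar>real_of_int \<lfloor>t * \<alpha> ^ n\<rfloor> - t * \<alpha> ^ n\<bar> \<le> 1" by linarith
    moreover have "\<epsilon> * t / 2 * \<alpha> ^ n = \<epsilon> * (t * \<alpha> ^ n) / 2" by simp
    ultimately have "\<bar>real_of_int (seq_term t \<alpha> P n) - t * \<alpha> ^ n\<bar> \<le> \<epsilon> * (t * \<alpha> ^ n)"
      unfolding seq_term_def of_int_add by linarith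
    moreover have "t * \<alpha> ^ n > 0" using t pos by simp
    ultimately show ?case by linarith
  qed
qed

theorem theorem1p4:
  fixes k :: nat and t \<alpha> :: real and P :: "nat \<Rightarrow> rat poly"
  defines "A \<equiv> seq_set t \<alpha> (P ` {1..k})"
  assumes "k \<ge> 2" and "t > 0" and "1 < \<alpha>" and "\<alpha> < alpha_bound k"
    and "P ` {1..k} \<subseteq> int_valued_polys"
    and "inj_on P {1..k}"
  shows "(strongly_complete A \<longleftrightarrow>
            (\<forall>\<theta>::real. \<theta> \<notin> \<int> \<longrightarrow>
              (\<Sum>\<^sub>\<infinity>a\<in>A. ennreal (dist_nearest_int (real a * \<theta>))) = \<infinity>))
       \<and> (strongly_complete A \<longleftrightarrow>
            (\<forall>p::nat. prime p \<longrightarrow> int p dvd diff_gcd k P \<longrightarrow>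
              infinite {n::nat. 1 \<le> n \<and> \<not> int p dvd seq_term t \<alpha> (P 1) n}))
       \<and> (diff_gcd k P = 1 \<longrightarrow> strongly_complete A)"
proof -
  let ?div = "\<forall>\<theta>::real. \<theta> \<notin> \<int> \<longrightarrow>
              (\<Sum>\<^sub>\<infinity>a\<in>A. ennreal (dist_nearest_int (real a * \<theta>))) = \<infinity>"
  let ?res = "\<forall>p::nat. prime p \<longrightarrow> int p dvd diff_gcd k P \<longrightarrow>
              infinite {n::nat. 1 \<le> n \<and> \<not> int p dvd seq_term t \<alpha> (P 1) n}"
  have iv: "P i \<in> int_valued_polys" if "i \<in> {1..k}" for i using assms that by auto
  define b where "b i n = nat (seq_term t \<alpha> (P i) n)" for i n
  have approx: "\<forall>\<^sub>F n in sequentially. \<forall>i\<in>{1..k}. \<bar>real (b i n) - t * \<alpha> ^ n\<bar> \<le> \<epsilon> * (t * \<alpha> ^ n)"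
    if "\<epsilon> > 0" for \<epsilon>
    unfolding b_def using seq_term_asymp[OF iv \<open>t > 0\<close> \<open>1 < \<alpha>\<close> that]
    by (intro eventually_ball_finite) auto
  have large: "\<forall>\<^sub>F n in sequentially. \<forall>i\<in>{1..k}. N < b i n" for N
  proof -
    have "filterlim (\<lambda>n. \<alpha> ^ n) at_top sequentially" using \<open>1 < \<alpha>\<close> by real_asymp
    then have "\<forall>\<^sub>F n in sequentially. 2 * real N / t < \<alpha> ^ n"
      by (simp add: filterlim_at_top_dense)
    moreover have "\<forall>\<^sub>F n in sequentially. \<forall>i\<in>{1..k}. \<bar>real (b i n) - t * \<alpha> ^ n\<bar> \<le> 1/2 * (t * \<alpha> ^ n)"
      by (rule approx) simp
    ultimately show ?thesis
    proof eventually_elim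
      case (elim n)
      have "2 * real N < t * \<alpha> ^ n" using elim(1) \<open>t > 0\<close> by (simp add: field_simps)
      show ?case
      proof
        fix i assume "i \<in> {1..k}"
        then have "\<bar>real (b i n) - t * \<alpha> ^ n\<bar> \<le> 1/2 * (t * \<alpha> ^ n)" using elim(2) by blast
        then show "N < b i n" using \<open>2 * real N < t * \<alpha> ^ n\<close> by linarith
      qed
    qed
  qed
  have int_b: "int (b i n) = seq_term t \<alpha> (P i) n" if "0 < b i n" for i n
    using that by (simp add: b_def)
  have diff: "rat_of_int (seq_term t \<alpha> (P i) n - seq_term t \<alpha> (P j) n) = poly (P i - P j) (of_nat n)"
    if "i \<in> {1..k}" "j \<in> {1..k}" for i j n
    using of_int_int_poly_val[OF iv[OF that(1)], of "int n"] of_int_int_poly_val[OF iv[OF that(2)], of "int n"]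
    by (simp add: seq_term_def)
  have inj: "\<forall>\<^sub>F n in sequentially. inj_on (\<lambda>i. b i n) {1..k}"
  proof -
    have "\<forall>\<^sub>F n in sequentially. \<forall>i\<in>{1..k}. \<forall>j\<in>{1..k}. i \<noteq> j \<longrightarrow> poly (P i - P j) (of_nat n) \<noteq> 0"
    proof (intro eventually_ball_finite ballI)
      fix i j assume "i \<in> {1..k}" "j \<in> {1..k}"
      then have "i \<noteq> j \<Longrightarrow> P i - P j \<noteq> 0" using \<open>inj_on P {1..k}\<close> by (auto dest: inj_onD)
      then show "\<forall>\<^sub>F n in sequentially. i \<noteq> j \<longrightarrow> poly (P i - P j) (of_nat n) \<noteq> 0"
        by (cases "i = j") (auto simp del: poly_diff intro: rat_poly_eventually_nonzero)
    qed auto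
    with large[of 0] show ?thesis
    proof eventually_elim
      case (elim n)
      show ?case
      proof (rule inj_onI, rule ccontr)
        fix i j assume ij: "i \<in> {1..k}" "j \<in> {1..k}" "b i n = b j n" "i \<noteq> j"
        then have "seq_term t \<alpha> (P i) n = seq_term t \<alpha> (P j) n" using int_b elim(1) by metis
        then show False using diff[OF ij(1,2), of n] elim(2) ij by (auto simp del: poly_diff)
      qed
    qed
  qed
  have in_A: "b i n \<in> A" if "i \<in> {1..k}" "n \<ge> 1" "0 < b i n" for i n
    using that int_b[of i n] unfolding A_def seq_set_def by fastforce
  have "?div" if "strongly_complete A" using strongly_complete_imp_divergent that by blast
  moreover have "?res" if div: "?div"
  proof (intro allI impI notI)
    fix p :: nat assume p: "prime p" "int p dvd diff_gcd k P"
      and fin: "finite {n. 1 \<le> n \<and> \<not> int p dvd seq_term t \<alpha> (P 1) n}"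
    have "int p dvd seq_term t \<alpha> (P 1) n \<longleftrightarrow> int p dvd seq_term t \<alpha> (P i) n" if i: "i \<in> {1..k}" for i n
    proof (cases "i = 1")
      case False
      then have "diff_gcd k P dvd int_poly_val (P 1) (int n) - int_poly_val (P i) (int n)"
        unfolding diff_gcd_def using i by (intro Gcd_dvd CollectI) fastforce
      then have "int p dvd int_poly_val (P 1) (int n) - int_poly_val (P i) (int n)"
        using p(2) by (rule dvd_trans[rotated])
      then have "int p dvd seq_term t \<alpha> (P 1) n - seq_term t \<alpha> (P i) n"
        by (simp add: seq_term_def)
      then show ?thesis by (metis dvd_diff_left_iff dvd_diff_right_iff)
    qed simp
    then have "{a \<in> A. \<not> p dvd a} \<subseteq>
        (\<Union>i\<in>{1..k}. b i ` {n. 1 \<le> n \<and> \<not> int p dvd seq_term t \<alpha> (P 1) n})"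
      unfolding A_def seq_set_def b_def by (force simp flip: int_dvd_int_iff)
    then have "finite {a \<in> A. \<not> p dvd a}"
      by (rule finite_subset) (use fin in auto)
    then show False using divergent_imp_infinite_nondivisible[OF p(1)] div by blast
  qed
  moreover have "strongly_complete A" if res: "?res"
    unfolding strongly_complete_def
  proof (intro allI impI)
    fix B assume B: "B \<subseteq> A" "finite B"
    \<comment> \<open>Beyond \<open>\<Sum>B\<close> no element of \<open>A\<close> lies in \<open>B\<close>, so the levels of \<open>A - B\<close> are eventually those of \<open>A\<close>.\<close>
    have le_B: "x \<le> \<Sum>B" if "x \<in> B" for x using member_le_sum[of x B "\<lambda>x. x"] B(2) that by simp
    have in_AB: "\<forall>\<^sub>F n in sequentially. \<forall>i\<in>{1..k}. b i n \<in> A - B"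
      using large[of "\<Sum>B"] eventually_ge_at_top[of 1]
    proof eventually_elim
      case (elim n)
      then show ?case using in_A le_B by (metis DiffI gr_implies_not0 gr0I leD)
    qed
    show "complete_set (A - B)"
    proof (rule complete_if_exponential_levels[OF assms(2-5) approx inj _ _ in_AB])
      show "P 1 - P 2 \<noteq> 0" using \<open>inj_on P {1..k}\<close> \<open>k \<ge> 2\<close> by (auto dest: inj_onD)
      show "\<forall>\<^sub>F n in sequentially. rat_of_int (int (b 1 n) - int (b 2 n)) = poly (P 1 - P 2) (of_nat n)"
        using large[of 0]
      proof eventually_elim
        case (elim n)
        then show ?case using diff[of 1 2 n] \<open>k \<ge> 2\<close> by (simp add: int_b)
      qed
      fix p :: nat assume p: "prime p"
      \<comment> \<open>A prime dividing the gcd is covered by (3); any other one fails to divide some difference of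
        two polynomials, and hence one of the two elements, at infinitely many levels.\<close>
      have often: "\<exists>n\<ge>N. \<exists>i\<in>{1..k}. \<not> int p dvd seq_term t \<alpha> (P i) n" for N
      proof (cases "int p dvd diff_gcd k P")
        case True
        then have "infinite {n. 1 \<le> n \<and> \<not> int p dvd seq_term t \<alpha> (P 1) n}" using res p by blast
        then show ?thesis using \<open>k \<ge> 2\<close> unfolding infinite_nat_iff_unbounded_le by fastforce
      next
        case False
        then obtain m i j where m: "\<not> int p dvd int_poly_val (P i) m - int_poly_val (P j) m"
          and ij: "i \<in> {1..k}" "j \<in> {1..k}"
          unfolding diff_gcd_def by (auto simp: dvd_Gcd_iff)
        have "\<exists>n\<ge>N. \<not> int p dvd int_poly_val (P i) (int n) - int_poly_val (P j) (int n)"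
        proof (rule rat_poly_nondivisible_recurs)
          show "\<not> int p dvd int_poly_val (P i) m - int_poly_val (P j) m" by (rule m)
          show "p > 0" using p by (rule prime_gt_0_nat)
          show "poly (P i - P j) (of_int n) = of_int (int_poly_val (P i) n - int_poly_val (P j) n)" for n
            using iv ij by (simp add: of_int_int_poly_val)
        qed
        then obtain n where n: "n \<ge> N" "\<not> int p dvd seq_term t \<alpha> (P i) n - seq_term t \<alpha> (P j) n"
          by (auto simp: seq_term_def)
        then show ?thesis using ij by (metis dvd_diff)
      qed
      show "infinite {a \<in> A - B. \<not> p dvd a}"
        unfolding infinite_nat_iff_unbounded
      proof
        fix N
        obtain n0 where n0: "\<And>n i. n \<ge> n0 \<Longrightarrow> i \<in> {1..k} \<Longrightarrow> N < b i n \<and> b i n \<in> A - B"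
          using eventually_conj[OF large[of N] in_AB] unfolding eventually_sequentially by blast
        obtain n i where n: "n \<ge> n0" "i \<in> {1..k}" "\<not> int p dvd seq_term t \<alpha> (P i) n"
          using often by blast
        then have "\<not> p dvd b i n" using n0[OF n(1,2)] int_b[of i n] by (metis gr_implies_not0 gr0I int_dvd_int_iff)
        then show "\<exists>a>N. a \<in> {a \<in> A - B. \<not> p dvd a}" using n0[OF n(1,2)] by blast
      qed
    qed
  qed
  moreover have "?res" if "diff_gcd k P = 1"
    using that by (auto dest: prime_gt_1_nat)
  ultimately show ?thesis by blast
qed

end
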